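(* Let $K$ be a compact metric space with $\dim_t K>0$. Then there exists a $G_\delta$ set $G\subseteq K$ with $\dim_H G=\dim_{tH}K-1$ such that for the generic $f\in C(K)$ (i) $f$ is one-to-one on $K\setminus G$, hence $\dim_H f^{-1}(y)\le\dim_{tH}K-1$ for every $y\in\mathbb{R}$; (ii) for every $d<\dim_{tH}K$ there exists a non-degenerate interval $I_{f,d}$ such that $\dim_H f^{-1}(y)\ge d-1$ for every $y\in I_{f,d}$.
   Context: $C(K)$ is the space of continuous functions $f\colon K\to\mathbb{R}$ with the supremum metric (a complete metric space). "For the generic $f\in C(K)$, property $\mathcal P$ holds" means that $\{f\in C(K): f\text{ has }\mathcal P\}$ is co-meager in $C(K)$ (its complement is a countable union of nowhere dense sets). $\dim_H$ denotes Hausdorff dimension, with the convention $\dim_H\emptyset=-1$. $\dim_t$ denotes the (small inductive) topological dimension: $\dim_t\emptyset=-1$ and, for non-empty $X$, inductively $\dim_t X=\inf\{d: X \text{ has a basis } \mathcal U \text{ with } \dim_t\partial U\le d-1 \text{ for every } U\in\mathcal U\}$. The topological Hausdorff dimension is defined by $\dim_{tH}\emptyset=-1$ and, for a non-empty metric space $X$, $\dim_{tH}X=\inf\{d: X \text{ has a basis } \mathcal U \text{ of open sets such that } \dim_H\partial U\le d-1 \text{ for every } U\in\mathcal U\}$. All these can take the value $\infty$ ($d=\infty$ is allowed), with the convention $\infty-1=\infty$. *)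

theory Defs
  imports "HOL-Analysis.Analysis"
begin

text \<open>The contribution \<open>(diam A)\<^sup>s\<close> of a covering set, with the conventions that the empty set
  contributes \<open>0\<close> and that \<open>0\<^sup>0 = 1\<close> (whereas \<open>0 powr 0 = 0\<close> in the library). It is only
  used for bounded sets, since \<^const>\<open>diameter\<close> has no meaning for unbounded ones.\<close>

definition diam_pow :: "real \<Rightarrow> 'a::metric_space set \<Rightarrow> real" where
  "diam_pow s A = (if A = {} then 0 else if s = 0 then 1 else diameter A powr s)"

definition hausdorff_pre_measure ::
    "real \<Rightarrow> real \<Rightarrow> 'a::metric_space set \<Rightarrow> ennreal" where
  "hausdorff_pre_measure s \<delta> X =
     (INF A \<in> {A :: nat \<Rightarrow> 'a set. X \<subseteq> (\<Union>i. A i) \<and> (\<forall>i. bounded (A i) \<and> diameter (A i) \<le> \<delta>)}.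
        \<Sum>i. ennreal (diam_pow s (A i)))"

text \<open>The limit as \<open>\<delta> \<rightarrow> 0\<close> is a supremum, because the premeasure decreases in \<open>\<delta>\<close>.\<close>

definition hausdorff_measure :: "real \<Rightarrow> 'a::metric_space set \<Rightarrow> ennreal" where
  "hausdorff_measure s X = (SUP \<delta> \<in> {0<..}. hausdorff_pre_measure s \<delta> X)"

definition hausdorff_dim :: "'a::metric_space set \<Rightarrow> ereal" where
  "hausdorff_dim X =
     (if X = {} then -1 else Inf {ereal s | s. 0 \<le> s \<and> hausdorff_measure s X = 0})"

definition base_of :: "'a set set \<Rightarrow> 'a topology \<Rightarrow> bool" where
  "base_of \<B> X \<longleftrightarrow> openin X = arbitrary union_of (\<lambda>U. U \<in> \<B>)"

text \<open>The library's predicate \<^const>\<open>dimension_le\<close> is the recursion defining the small inductive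
  dimension, started at \<open>- 1\<close> for the empty space. The usual recursive characterisation in terms
  of bases is \<open>small_ind_dim_rec\<close> below.\<close>

definition small_ind_dim :: "'a topology \<Rightarrow> ereal" where
  "small_ind_dim X = Inf {ereal (real_of_int n) | n. X dim_le n}"

lemma base_of_iff:
  "base_of \<B> X \<longleftrightarrow>
     (\<forall>U\<in>\<B>. openin X U) \<and> (\<forall>V x. openin X V \<and> x \<in> V \<longrightarrow> (\<exists>U\<in>\<B>. x \<in> U \<and> U \<subseteq> V))"
  proof
  assume "base_of \<B> X"
  then show "(\<forall>U\<in>\<B>. openin X U) \<and>
      (\<forall>V x. openin X V \<and> x \<in> V \<longrightarrow> (\<exists>U\<in>\<B>. x \<in> U \<and> U \<subseteq> V))"
    unfolding base_of_def by (auto simp: arbitrary_union_of_alt)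
next
  assume *: "(\<forall>U\<in>\<B>. openin X U) \<and>
      (\<forall>V x. openin X V \<and> x \<in> V \<longrightarrow> (\<exists>U\<in>\<B>. x \<in> U \<and> U \<subseteq> V))"
  show "base_of \<B> X"
    unfolding base_of_def
  proof (intro ext iffI)
    fix S assume "openin X S"
    then show "(arbitrary union_of (\<lambda>U. U \<in> \<B>)) S"
      using * unfolding arbitrary_union_of_alt by blast
  next
    fix S assume "(arbitrary union_of (\<lambda>U. U \<in> \<B>)) S"
    then show "openin X S"
      using * unfolding union_of_def arbitrary_def by (auto intro!: openin_Union)
  qed
qed

lemma small_ind_dim_leI: "X dim_le n \<Longrightarrow> small_ind_dim X \<le> ereal (real_of_int n)"
  unfolding small_ind_dim_def by (rule Inf_lower) blast

lemma small_ind_dim_ge: "- 1 \<le> small_ind_dim X"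
  unfolding small_ind_dim_def
  by (rule Inf_greatest) (force dest: dimension_le_bound simp: one_ereal_def)

lemma small_ind_dim_leD:
  assumes "small_ind_dim X \<le> ereal r"
  shows "X dim_le \<lfloor>r\<rfloor>"
proof -
  have "small_ind_dim X < ereal (real_of_int (\<lfloor>r\<rfloor> + 1))"
    using assms by (rule order_le_less_trans) simp
  then obtain n where n: "X dim_le n" "real_of_int n < real_of_int (\<lfloor>r\<rfloor> + 1)"
    unfolding small_ind_dim_def Inf_less_iff by auto
  then have "n \<le> \<lfloor>r\<rfloor>" by linarith
  with n(1) show ?thesis by (rule dimension_le_mono)
qed

lemma small_ind_dim_empty:
  assumes "topspace X = {}"
  shows "small_ind_dim X = - 1"
proof (rule antisym)
  have "X dim_le - 1" using assms by (simp add: dimension_le_eq_empty)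
  from small_ind_dim_leI[OF this] show "small_ind_dim X \<le> - 1" by (simp add: one_ereal_def)
qed (rule small_ind_dim_ge)

lemma small_ind_dim_rec:
  assumes ne: "topspace X \<noteq> {}"
  shows "small_ind_dim X =
    Inf {d. \<exists>\<B>. base_of \<B> X \<and>
              (\<forall>U\<in>\<B>. small_ind_dim (subtopology X (X frontier_of U)) \<le> d - 1)}"
    (is "_ = Inf ?D")
proof (rule antisym)
  show "small_ind_dim X \<le> Inf ?D"
  proof (rule Inf_greatest)
    fix d assume "d \<in> ?D"
    then obtain \<B> where B: "base_of \<B> X"
      and bd: "\<And>U. U \<in> \<B> \<Longrightarrow> small_ind_dim (subtopology X (X frontier_of U)) \<le> d - 1"
      by auto
    obtain U where "U \<in> \<B>"
      using ne B unfolding base_of_iff by (metis ex_in_conv openin_topspace)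
    then have d1: "- 1 \<le> d - 1"
      using bd small_ind_dim_ge order_trans by blast
    show "small_ind_dim X \<le> d"
    proof (cases d)
      case (real r)
      have r0: "0 \<le> r" using d1 real by (simp add: one_ereal_def)
      have "X dim_le \<lfloor>r\<rfloor>"
      proof (rule dimension_le.intros)
        show "- 1 \<le> \<lfloor>r\<rfloor>" using r0 by linarith
        fix V a assume "openin X V" "a \<in> V"
        then obtain U where U: "U \<in> \<B>" "a \<in> U" "U \<subseteq> V" "openin X U"
          using B unfolding base_of_iff by metis
        have "small_ind_dim (subtopology X (X frontier_of U)) \<le> ereal (r - 1)"
          using bd[OF U(1)] real by (simp add: one_ereal_def)
        then have "subtopology X (X frontier_of U) dim_le \<lfloor>r - 1\<rfloor>"
          by (rule small_ind_dim_leD)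
        then show "\<exists>U. a \<in> U \<and> U \<subseteq> V \<and> openin X U \<and>
            subtopology X (X frontier_of U) dim_le \<lfloor>r\<rfloor> - 1"
          using U by auto
      qed
      then have "small_ind_dim X \<le> ereal (real_of_int \<lfloor>r\<rfloor>)" by (rule small_ind_dim_leI)
      also have "\<dots> \<le> d" using real by simp
      finally show ?thesis .
    qed (use d1 in \<open>auto simp: one_ereal_def\<close>)
  qed
next
  show "Inf ?D \<le> small_ind_dim X"
    unfolding small_ind_dim_def[of X]
  proof (rule Inf_greatest)
    fix d assume "d \<in> {ereal (real_of_int n) | n. X dim_le n}"
    then obtain n where n: "X dim_le n" and d: "d = ereal (real_of_int n)" by blast
    let ?B = "{U. openin X U \<and> subtopology X (X frontier_of U) dim_le n - 1}"
    have "base_of ?B X"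
      using n unfolding base_of_iff dimension_le.simps[of X n] by blast
    moreover have "\<forall>U\<in>?B. small_ind_dim (subtopology X (X frontier_of U)) \<le> d - 1"
      using small_ind_dim_leI by (fastforce simp: d one_ereal_def)
    ultimately have "d \<in> ?D" by blast
    then show "Inf ?D \<le> d" by (rule Inf_lower)
  qed
qed

definition top_hausdorff_dim :: "'a::metric_space set \<Rightarrow> ereal" where
  "top_hausdorff_dim X =
     (if X = {} then -1
      else Inf {d. \<exists>\<B>. base_of \<B> (top_of_set X) \<and>
                        (\<forall>U\<in>\<B>. hausdorff_dim (top_of_set X frontier_of U) \<le> d - 1)})"

definition nowhere_dense :: "'a::topological_space set \<Rightarrow> bool" where
  "nowhere_dense S \<longleftrightarrow> interior (closure S) = {}"

definition meager :: "'a::topological_space set \<Rightarrow> bool" where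
  "meager S \<longleftrightarrow> (\<exists>A :: nat \<Rightarrow> 'a set. (\<forall>n. nowhere_dense (A n)) \<and> S = (\<Union>n. A n))"

definition comeager :: "'a::topological_space set \<Rightarrow> bool" where
  "comeager S \<longleftrightarrow> meager (- S)"

end

theory Submission
  imports Defs
begin

text \<open>Write \<open>D\<close> for the topological Hausdorff dimension of the space. For every rational \<open>q > D\<close> there
  is a countable base whose frontiers are null sets for the \<open>(q - 1)\<close>-dimensional Hausdorff measure;
  \<open>G\<close> is the intersection over \<open>q\<close> of \<open>G\<^sub>\<delta>\<close> null hulls of the unions of these frontiers. Its
  complement is a countable union of compact sets, any two of which miss the frontiers of a
  common base, so that the functions separating points of them at distance at least \<open>\<delta>\<close> form a
  dense open set. This gives injectivity off \<open>G\<close>.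

  For \<open>d < D\<close>, the open sets whose frontiers have dimension at most \<open>d - 1\<close> do not form a base, so some
  point \<open>x\<close> has a neighbourhood in which every smaller neighbourhood of \<open>x\<close> has a frontier of larger
  dimension. Digging a small pit at \<open>x\<close> into a given function turns frontiers of sublevel sets into
  parts of level sets, for an interval of levels and stably under perturbation. Comparing both
  properties for one generic function shows that \<open>G\<close> has dimension at least \<open>D - 1\<close>.\<close>

section \<open>Sets of Hausdorff measure zero\<close>

text \<open>A single number \<open>e\<close> bounds both the mesh and the sum. If the measure is
  zero, so is the premeasure at every scale, and its infimum falls below \<open>e\<close>.
  Conversely, a cover obtained for \<open>min e \<delta>\<close> is admissible at scale
  \<open>\<delta>\<close> and has sum at most \<open>e\<close>. The later arguments use only null
  sets, so this criterion replaces the measure itself.\<close>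

lemma hausdorff_null_iff:
  "hausdorff_measure s X = 0 \<longleftrightarrow>
    (\<forall>e>0. \<exists>A :: nat \<Rightarrow> 'a::metric_space set. X \<subseteq> (\<Union>i. A i) \<and>
      (\<forall>i. bounded (A i) \<and> diameter (A i) \<le> e) \<and>
      (\<Sum>i. ennreal (diam_pow s (A i))) \<le> ennreal e)"
    (is "_ \<longleftrightarrow> (\<forall>e>0. ?P e)")
proof
  assume null: "hausdorff_measure s X = 0"
  show "\<forall>e>0. ?P e"
  proof (intro allI impI)
    fix e :: real assume e: "e > 0"
    have "hausdorff_pre_measure s e X \<le> hausdorff_measure s X"
      unfolding hausdorff_measure_def using e by (intro SUP_upper) simp
    then have "hausdorff_pre_measure s e X < ennreal e"
      using null e by simp
    then show "?P e"
      unfolding hausdorff_pre_measure_def INF_less_iff by (auto intro: less_imp_le)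
  qed
next
  assume P: "\<forall>e>0. ?P e"
  have "hausdorff_pre_measure s \<delta> X = 0" if \<delta>: "\<delta> > 0" for \<delta>
  proof -
    have *: "hausdorff_pre_measure s \<delta> X \<le> 0 + ennreal e" if e: "e > 0" for e
    proof -
      have "min e \<delta> > 0" using e \<delta> by simp
      then obtain A :: "nat \<Rightarrow> 'a set" where A: "X \<subseteq> (\<Union>i. A i)"
        "\<And>i. bounded (A i)" "\<And>i. diameter (A i) \<le> min e \<delta>"
        "(\<Sum>i. ennreal (diam_pow s (A i))) \<le> ennreal (min e \<delta>)"
        using P[rule_format, OF \<open>min e \<delta> > 0\<close>] by blast
      have "hausdorff_pre_measure s \<delta> X \<le> (\<Sum>i. ennreal (diam_pow s (A i)))"
        unfolding hausdorff_pre_measure_def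
        using A(1,2) order_trans[OF A(3) min.cobounded2] by (intro INF_lower) auto
      also have "\<dots> \<le> ennreal e"
        using A(4) by (rule order_trans) (simp add: ennreal_leI)
      finally show ?thesis by simp
    qed
    have "hausdorff_pre_measure s \<delta> X \<le> 0"
      by (rule ennreal_le_epsilon) (rule *)
    then show ?thesis by simp
  qed
  then have "hausdorff_measure s X \<le> 0"
    unfolding hausdorff_measure_def by (intro SUP_least) simp
  then show "hausdorff_measure s X = 0" by simp
qed

lemmas hausdorff_nullI = hausdorff_null_iff[THEN iffD2, rule_format]

lemma hausdorff_nullE:
  fixes X :: "'a::metric_space set"
  assumes "hausdorff_measure s X = 0" "e > 0"
  obtains A :: "nat \<Rightarrow> 'a set" where "X \<subseteq> (\<Union>i. A i)"
    "\<And>i. bounded (A i)" "\<And>i. diameter (A i) \<le> e"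
    "(\<Sum>i. ennreal (diam_pow s (A i))) \<le> ennreal e"
  using hausdorff_null_iff[THEN iffD1, rule_format, OF assms] by blast

lemma hausdorff_null_subset:
  assumes "hausdorff_measure s Y = 0" "X \<subseteq> Y"
  shows "hausdorff_measure s X = 0"
proof (rule hausdorff_nullI)
  fix e :: real assume "e > 0"
  then obtain A where "Y \<subseteq> (\<Union>i. A i)"
    "\<And>i. bounded (A i)" "\<And>i. diameter (A i) \<le> e"
    "(\<Sum>i. ennreal (diam_pow s (A i))) \<le> ennreal e"
    using hausdorff_nullE[OF assms(1)] by metis
  then show "\<exists>A. X \<subseteq> (\<Union>i. A i) \<and> (\<forall>i. bounded (A i) \<and> diameter (A i) \<le> e) \<and>
      (\<Sum>i. ennreal (diam_pow s (A i))) \<le> ennreal e"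
    using assms(2) by (intro exI[of _ A]) auto
qed

lemma hausdorff_null_empty [simp]: "hausdorff_measure s {} = 0"
  by (rule hausdorff_nullI, rule exI[of _ "\<lambda>_. {}"]) (simp add: diam_pow_def)

text \<open>Points are null only for positive exponents: for \<open>s = 0\<close> the convention 0^0
  = 1 lets a one-point set contribute 1. This is the source of the condition \<open>s > 0\<close>
  wherever a point is added to a null set.\<close>

lemma hausdorff_null_singleton:
  assumes "s > 0"
  shows "hausdorff_measure s {x :: 'a::metric_space} = 0"
  by (rule hausdorff_nullI, rule exI[of _ "\<lambda>_. {x}"]) (use assms in \<open>simp add: diam_pow_def\<close>)

lemma hausdorff_null_UN:
  fixes X :: "nat \<Rightarrow> 'a::metric_space set"
  assumes null: "\<And>n. hausdorff_measure s (X n) = 0"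
  shows "hausdorff_measure s (\<Union>n. X n) = 0"
proof (rule hausdorff_nullI)
  fix e :: real assume e: "e > 0"
  define \<eta> where "\<eta> n = e * (1/2) ^ Suc n" for n
  have \<eta>: "\<eta> n > 0" "\<eta> n \<le> e" for n
    using e by (auto simp: \<eta>_def mult_le_cancel_left1 simp flip: power_Suc intro!: power_le_one)
  have "\<forall>n. \<exists>A :: nat \<Rightarrow> 'a set. X n \<subseteq> (\<Union>i. A i) \<and>
      (\<forall>i. bounded (A i) \<and> diameter (A i) \<le> \<eta> n) \<and>
      (\<Sum>i. ennreal (diam_pow s (A i))) \<le> ennreal (\<eta> n)"
    using hausdorff_null_iff[THEN iffD1, rule_format, OF null \<eta>(1)] by blast
  then obtain A :: "nat \<Rightarrow> nat \<Rightarrow> 'a set" where A: "\<And>n. X n \<subseteq> (\<Union>i. A n i)"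
      "\<And>n i. bounded (A n i)" "\<And>n i. diameter (A n i) \<le> \<eta> n"
      "\<And>n. (\<Sum>i. ennreal (diam_pow s (A n i))) \<le> ennreal (\<eta> n)"
    by metis
  define B where "B k = case_prod A (prod_decode k)" for k
  have "(\<Sum>k. ennreal (diam_pow s (B k))) = (\<Sum>n. \<Sum>i. ennreal (diam_pow s (A n i)))"
    using suminf_ennreal_2dimen[of "\<lambda>n. \<Sum>i. ennreal (diam_pow s (A n i))"
        "\<lambda>p. ennreal (diam_pow s (case_prod A p))"]
    by (simp add: B_def)
  also have "\<dots> \<le> (\<Sum>n. ennreal (\<eta> n))"
    by (intro suminf_le A) auto
  also have "\<dots> = ennreal e"
  proof (rule suminf_ennreal_eq)
    show "\<eta> sums e"
      unfolding \<eta>_def using sums_mult[OF power_half_series, of e] by simp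
  qed (use \<eta> less_imp_le in blast)
  finally have "(\<Sum>k. ennreal (diam_pow s (B k))) \<le> ennreal e" .
  moreover have "(\<Union>n. X n) \<subseteq> (\<Union>k. B k)"
  proof
    fix x assume "x \<in> (\<Union>n. X n)"
    then obtain n i where "x \<in> A n i" using A(1) by blast
    then have "x \<in> B (prod_encode (n, i))" by (simp add: B_def)
    then show "x \<in> (\<Union>k. B k)" by blast
  qed
  moreover have "bounded (B k) \<and> diameter (B k) \<le> e" for k
    unfolding B_def using A(2) order_trans[OF A(3) \<eta>(2)] by (auto split: prod.split)
  ultimately show "\<exists>A :: nat \<Rightarrow> 'a set. (\<Union>n. X n) \<subseteq> (\<Union>i. A i) \<and>
      (\<forall>i. bounded (A i) \<and> diameter (A i) \<le> e) \<and>
      (\<Sum>i. ennreal (diam_pow s (A i))) \<le> ennreal e" by blast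
qed

lemma hausdorff_null_Union:
  assumes "countable \<X>" "\<And>X. X \<in> \<X> \<Longrightarrow> hausdorff_measure s X = 0"
  shows "hausdorff_measure s (\<Union>\<X>) = 0"
proof (cases "\<X> = {}")
  case False
  then have "\<Union>\<X> = (\<Union>n. from_nat_into \<X> n)"
    using assms(1) by (simp add: range_from_nat_into)
  then show ?thesis
    using hausdorff_null_UN[of s "from_nat_into \<X>"] assms(2) from_nat_into[OF False] by simp
qed simp

lemma hausdorff_null_mono_exponent:
  fixes X :: "'a::metric_space set"
  assumes null: "hausdorff_measure s X = 0" and "0 \<le> s" "s \<le> t"
  shows "hausdorff_measure t X = 0"
proof (rule hausdorff_nullI)
  fix e :: real assume e: "e > 0"
  \<comment> \<open>Mesh at most 1 makes the contribution of each set decrease as the exponent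
    grows. For \<open>s = 0\<close> the larger contribution is 1, so the bound
    \<open>diameter (A i) powr t \<le> 1\<close> is what counts.\<close>
  then have "min e 1 > 0" by simp
  then obtain A :: "nat \<Rightarrow> 'a set" where A: "X \<subseteq> (\<Union>i. A i)"
      "\<And>i. bounded (A i)" "\<And>i. diameter (A i) \<le> min e 1"
      "(\<Sum>i. ennreal (diam_pow s (A i))) \<le> ennreal (min e 1)"
    using hausdorff_nullE[OF null] by metis
  have "diam_pow t (A i) \<le> diam_pow s (A i)" for i
  proof (cases "diameter (A i) = 0")
    case False
    then have d: "0 < diameter (A i)" "diameter (A i) \<le> 1"
      using diameter_ge_0[OF A(2)] A(3)[of i] by (auto simp: less_le)
    then have "diameter (A i) powr t \<le> diameter (A i) powr s" "diameter (A i) powr t \<le> 1"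
      using assms by (auto intro: powr_mono' powr_le1)
    then show ?thesis using assms by (auto simp: diam_pow_def)
  qed (use assms in \<open>auto simp: diam_pow_def\<close>)
  then have "(\<Sum>i. ennreal (diam_pow t (A i))) \<le> (\<Sum>i. ennreal (diam_pow s (A i)))"
    by (intro suminf_le ennreal_leI) auto
  also have "\<dots> \<le> ennreal e"
    using A(4) by (rule order_trans) (simp add: ennreal_leI)
  finally show "\<exists>A :: nat \<Rightarrow> 'a set. X \<subseteq> (\<Union>i. A i) \<and>
      (\<forall>i. bounded (A i) \<and> diameter (A i) \<le> e) \<and>
      (\<Sum>i. ennreal (diam_pow t (A i))) \<le> ennreal e"
    using A(1,2) order_trans[OF A(3) min.cobounded1] by blast
qed

section \<open>Open covers and null hulls\<close>

text \<open>The union of the balls of radius \<open>r\<close> around points of \<open>A\<close> has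
  diameter at most \<open>diameter A + 2 * r\<close>. Since \<open>s > 0\<close>, the power is
  continuous from the right even at diameter zero, so a small \<open>r\<close> meets both
  bounds.\<close>

lemma open_enlargement:
  fixes A :: "'a::metric_space set"
  assumes "bounded A" "s > 0" "e > 0"
  obtains U where "open U" "A \<subseteq> U" "bounded U" "diameter U \<le> diameter A + e"
    "diam_pow s U \<le> diam_pow s A + e"
proof (cases "A = {}")
  case True
  then show ?thesis using that[of "{}"] assms by (auto simp: diam_pow_def)
next
  case False
  define d where "d = diameter A"
  have d0: "0 \<le> d" unfolding d_def by (rule diameter_ge_0[OF assms(1)])
  have "((\<lambda>r. (d + 2 * r) powr s) \<longlongrightarrow> (d + 2 * 0) powr s) (at_right 0)"
  proof (rule tendsto_powr2)
    show "((\<lambda>r. d + 2 * r) \<longlongrightarrow> d + 2 * 0) (at_right 0)" by (intro tendsto_intros)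
    show "\<forall>\<^sub>F r in at_right 0. 0 \<le> d + 2 * r"
      using d0 by (auto simp: eventually_at_filter)
  qed (use assms in auto)
  then have "\<forall>\<^sub>F r in at_right 0. (d + 2 * r) powr s < d powr s + e"
    using assms by (intro order_tendstoD) auto
  moreover have "\<forall>\<^sub>F r in at_right 0. r < e / 2"
    using assms by (intro order_tendstoD[of id 0, simplified]) (auto simp: id_def)
  moreover have "\<forall>\<^sub>F r :: real in at_right 0. 0 < r"
    by (auto simp: eventually_at_filter)
  ultimately have "\<forall>\<^sub>F r in at_right 0. (d + 2 * r) powr s < d powr s + e \<and> r < e / 2 \<and> 0 < r"
    by (auto intro: eventually_conj)
  then obtain r where r: "(d + 2 * r) powr s < d powr s + e" "r < e / 2" "0 < r"
    using eventually_happens'[OF trivial_limit_at_right_real] by blast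
  define U where "U = (\<Union>x\<in>A. ball x r)"
  have dist: "dist u v \<le> d + 2 * r" if uv: "u \<in> U" "v \<in> U" for u v
  proof -
    obtain x y where xy: "x \<in> A" "y \<in> A" "dist x u < r" "dist y v < r"
      using uv unfolding U_def UN_iff mem_ball by blast
    have "dist u v \<le> dist x u + dist x y + dist y v"
      using dist_triangle[of u v x] dist_triangle[of x v y] by (simp add: dist_commute)
    also have "dist x y \<le> d"
      using xy assms(1) by (simp add: d_def diameter_bounded_bound)
    finally show ?thesis using xy by simp
  qed
  have bU: "bounded U"
    unfolding bounded_two_points using dist by blast
  have AU: "A \<subseteq> U" using r by (auto simp: U_def)
  have dU: "diameter U \<le> d + 2 * r"
    using False AU dist by (auto simp: diameter_def intro!: cSUP_least)
  have "diam_pow s U \<le> diam_pow s A + e"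
  proof -
    have "diameter U powr s \<le> (d + 2 * r) powr s"
      using dU assms diameter_ge_0[OF bU] by (intro powr_mono2) auto
    then show ?thesis
      using r False AU assms by (auto simp: diam_pow_def d_def)
  qed
  moreover have "open U" by (auto simp: U_def)
  ultimately show ?thesis using that[of U] bU AU dU r by (simp add: d_def)
qed

text \<open>Enlarging the sets of a cover of sum \<open>e / 2\<close> with errors that add up to
  \<open>e / 2\<close> gives an open cover of sum at most \<open>e\<close>. Take \<open>O' n\<close>
  to be the union of such a cover for \<open>e = 1/(n+1)\<close>: the intersection is covered by all
  of these covers at once, hence it is null.\<close>

lemma hausdorff_null_open_hull:
  fixes X :: "'a::metric_space set"
  assumes null: "hausdorff_measure s X = 0" and s: "s > 0"
  obtains O' :: "nat \<Rightarrow> 'a set" where "\<And>n. open (O' n)" "\<And>n. X \<subseteq> O' n"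
    "hausdorff_measure s (\<Inter>n. O' n) = 0"
proof -
  have ex: "\<exists>U :: nat \<Rightarrow> 'a set. X \<subseteq> (\<Union>i. U i) \<and> (\<forall>i. open (U i)) \<and>
      (\<forall>i. bounded (U i) \<and> diameter (U i) \<le> e) \<and>
      (\<Sum>i. ennreal (diam_pow s (U i))) \<le> ennreal e" if e: "e > 0" for e
  proof -
    have "e / 2 > 0" using e by simp
    then obtain A :: "nat \<Rightarrow> 'a set" where A: "X \<subseteq> (\<Union>i. A i)"
        "\<And>i. bounded (A i)" "\<And>i. diameter (A i) \<le> e / 2"
        "(\<Sum>i. ennreal (diam_pow s (A i))) \<le> ennreal (e / 2)"
      using hausdorff_nullE[OF null] by metis
    define \<eta> where "\<eta> n = e / 2 * (1/2) ^ Suc n" for n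
    have \<eta>: "\<eta> n > 0" "\<eta> n \<le> e / 2" for n
      using e by (auto simp: \<eta>_def mult_le_cancel_left1 simp flip: power_Suc intro!: power_le_one)
    have "\<forall>i. \<exists>U. open U \<and> A i \<subseteq> U \<and> bounded U \<and> diameter U \<le> diameter (A i) + \<eta> i \<and>
        diam_pow s U \<le> diam_pow s (A i) + \<eta> i"
      using open_enlargement[OF A(2) s \<eta>(1)] by metis
    then obtain U where U: "\<And>i. open (U i)" "\<And>i. A i \<subseteq> U i" "\<And>i. bounded (U i)"
        "\<And>i. diameter (U i) \<le> diameter (A i) + \<eta> i"
        "\<And>i. diam_pow s (U i) \<le> diam_pow s (A i) + \<eta> i"
      by metis
    have "(\<Sum>i. ennreal (diam_pow s (U i))) \<le> (\<Sum>i. ennreal (diam_pow s (A i)) + ennreal (\<eta> i))"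
    proof (intro suminf_le)
      fix i
      have "ennreal (diam_pow s (U i)) \<le> ennreal (diam_pow s (A i) + \<eta> i)"
        by (intro ennreal_leI U)
      also have "\<dots> = ennreal (diam_pow s (A i)) + ennreal (\<eta> i)"
        using \<eta>(1)[of i] by (intro ennreal_plus) (auto simp: diam_pow_def)
      finally show "ennreal (diam_pow s (U i)) \<le> ennreal (diam_pow s (A i)) + ennreal (\<eta> i)" .
    qed auto
    also have "\<dots> = (\<Sum>i. ennreal (diam_pow s (A i))) + (\<Sum>i. ennreal (\<eta> i))"
      by (intro suminf_add[symmetric]) auto
    also have "(\<Sum>i. ennreal (\<eta> i)) = ennreal (e / 2)"
    proof (rule suminf_ennreal_eq)
      show "\<eta> sums (e / 2)"
        unfolding \<eta>_def using sums_mult[OF power_half_series, of "e / 2"] by simp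
    qed (use \<eta> less_imp_le in blast)
    also have "(\<Sum>i. ennreal (diam_pow s (A i))) + ennreal (e / 2) \<le> ennreal (e / 2) + ennreal (e / 2)"
      by (intro add_right_mono A)
    also have "\<dots> = ennreal e"
      using e by (simp flip: ennreal_plus)
    finally have "(\<Sum>i. ennreal (diam_pow s (U i))) \<le> ennreal e" .
    moreover have "diameter (U i) \<le> e" for i
      using U(4)[of i] A(3)[of i] \<eta>(2)[of i] by linarith
    moreover have "X \<subseteq> (\<Union>i. U i)" using A(1) U(2) by blast
    ultimately show ?thesis using U by blast
  qed
  have "\<forall>n. \<exists>U :: nat \<Rightarrow> 'a set. X \<subseteq> (\<Union>i. U i) \<and> (\<forall>i. open (U i)) \<and>
      (\<forall>i. bounded (U i) \<and> diameter (U i) \<le> inverse (Suc n)) \<and>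
      (\<Sum>i. ennreal (diam_pow s (U i))) \<le> ennreal (inverse (Suc n))"
    using ex by (metis inverse_positive_iff_positive of_nat_0_less_iff zero_less_Suc)
  then obtain U :: "nat \<Rightarrow> nat \<Rightarrow> 'a set" where U: "\<And>n. X \<subseteq> (\<Union>i. U n i)" "\<And>n i. open (U n i)"
      "\<And>n i. bounded (U n i)" "\<And>n i. diameter (U n i) \<le> inverse (Suc n)"
      "\<And>n. (\<Sum>i. ennreal (diam_pow s (U n i))) \<le> ennreal (inverse (Suc n))"
    by metis
  have "hausdorff_measure s (\<Inter>n. \<Union>i. U n i) = 0"
  proof (rule hausdorff_nullI)
    fix e :: real assume "e > 0"
    then obtain n where n: "inverse (real (Suc n)) < e"
      using reals_Archimedean by blast
    have "(\<Sum>i. ennreal (diam_pow s (U n i))) \<le> ennreal e"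
      using U(5)[of n] n by (meson ennreal_leI less_imp_le order_trans)
    moreover have "diameter (U n i) \<le> e" for i
      using U(4)[of n i] n by linarith
    ultimately show "\<exists>A :: nat \<Rightarrow> 'a set. (\<Inter>n. \<Union>i. U n i) \<subseteq> (\<Union>i. A i) \<and>
      (\<forall>i. bounded (A i) \<and> diameter (A i) \<le> e) \<and>
      (\<Sum>i. ennreal (diam_pow s (A i))) \<le> ennreal e"
      using U(3) by (intro exI[of _ "U n"]) auto
  qed
  then show ?thesis using that[of "\<lambda>n. \<Union>i. U n i"] U by blast
qed

section \<open>Hausdorff dimension\<close>

lemma hausdorff_dim_nonneg: "X \<noteq> {} \<Longrightarrow> 0 \<le> hausdorff_dim X"
  by (auto simp: hausdorff_dim_def intro: Inf_greatest)

lemma hausdorff_dim_le: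
  assumes "hausdorff_measure s X = 0" "0 \<le> s"
  shows "hausdorff_dim X \<le> ereal s"
proof (cases "X = {}")
  case True
  have "(-1 :: ereal) \<le> ereal s" using assms by (simp add: one_ereal_def)
  with True show ?thesis by (simp add: hausdorff_dim_def)
qed (use assms in \<open>auto simp: hausdorff_dim_def intro!: Inf_lower\<close>)

lemma hausdorff_null_if_dim_less:
  assumes "hausdorff_dim X < ereal s"
  shows "hausdorff_measure s X = 0"
proof (cases "X = {}")
  case False
  then obtain t where "0 \<le> t" "t < s" "hausdorff_measure t X = 0"
    using assms by (auto simp: hausdorff_dim_def Inf_less_iff)
  then show ?thesis using hausdorff_null_mono_exponent[of t X s] by simp
qed simp

text \<open>The bound is an extended real because it is applied to the topological Hausdorff
  dimension minus 1, which may be \<infinity>; in that case no exponent satisfies the premise and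
  the claim is trivial.\<close>

lemma hausdorff_dim_le_if_null:
  assumes "0 \<le> e" and null: "\<And>s. e < ereal s \<Longrightarrow> hausdorff_measure s X = 0"
  shows "hausdorff_dim X \<le> e"
proof (rule dense_ge)
  fix t assume "e < t"
  then obtain s where s: "e < ereal s" "ereal s < t"
    using ereal_dense2 by blast
  then have "0 \<le> s" using assms(1) by (metis ereal_less_eq(5) less_imp_le order_trans)
  then show "hausdorff_dim X \<le> t"
    using hausdorff_dim_le[OF null] s by (meson less_imp_le order_trans)
qed

lemma hausdorff_dim_mono:
  assumes "X \<subseteq> Y"
  shows "hausdorff_dim X \<le> hausdorff_dim Y"
proof (cases "X = {}")
  case True
  then show ?thesis
    using hausdorff_dim_nonneg[of Y] order_trans[of "-1" "0::ereal"]
    by (cases "Y = {}") (auto simp: hausdorff_dim_def)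
next
  case False
  then show ?thesis
    using assms hausdorff_dim_nonneg[of Y]
    by (intro hausdorff_dim_le_if_null) (auto intro: hausdorff_null_subset hausdorff_null_if_dim_less)
qed

lemma hausdorff_null_insert:
  assumes "hausdorff_measure s X = 0" "s > 0"
  shows "hausdorff_measure s (insert x X) = 0"
  using hausdorff_null_Union[of "{X, {x}}" s] assms hausdorff_null_singleton[of s x]
  by (auto simp: insert_commute)

section \<open>Comeager sets of continuous functions\<close>

lemma comeagerI:
  assumes "countable \<E>" "\<And>E. E \<in> \<E> \<Longrightarrow> open E \<and> closure E = UNIV" "\<Inter>\<E> \<subseteq> S"
  shows "comeager S"
proof -
  \<comment> \<open>Adding \<open>UNIV\<close> makes the family nonempty, so that it can be
    enumerated by the natural numbers.\<close>
  define E where "E n = from_nat_into (insert UNIV \<E>) n" for n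
  have rE: "range E = insert UNIV \<E>"
    unfolding E_def using assms(1) by (intro range_from_nat_into) auto
  have E: "open (E n)" "closure (E n) = UNIV" for n
    using rE assms(2) by (metis UNIV_I closure_UNIV imageI insertE open_UNIV)+
  have "nowhere_dense (- S - E n)" for n
  proof -
    have "closure (- S - E n) \<subseteq> - E n"
      using E(1) by (intro closure_minimal) auto
    then have "interior (closure (- S - E n)) \<subseteq> interior (- E n)"
      by (rule interior_mono)
    then show ?thesis
      using E(2)[of n] by (simp add: nowhere_dense_def interior_complement)
  qed
  \<comment> \<open>Cutting the complements of the \<open>E n\<close> down to \<open>- S\<close>
    gives equality, which \<open>meager\<close> demands, rather than mere inclusion.\<close>
  moreover have "- S = (\<Union>n. - S - E n)"
  proof -
    have "(\<Inter>n. E n) \<subseteq> S" using assms(3) rE by auto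
    then show ?thesis by blast
  qed
  ultimately show ?thesis
    unfolding comeager_def meager_def by (intro exI[of _ "\<lambda>n. - S - E n"]) blast
qed

lemma Baire_nonempty:
  fixes \<E> :: "'a::complete_space set set"
  assumes "countable \<E>" "\<And>E. E \<in> \<E> \<Longrightarrow> open E \<and> closure E = UNIV"
  shows "\<Inter>\<E> \<noteq> {}"
proof -
  have "(euclidean :: 'a topology) closure_of \<Inter>\<E> = topspace euclidean"
    using assms completely_metrizable_space_euclidean
    by (intro Baire_category) auto
  then show ?thesis by auto
qed

lemma dense_bcontfunI:
  fixes E :: "('a::topological_space \<Rightarrow>\<^sub>C real) set"
  assumes "\<And>g e. e > 0 \<Longrightarrow> \<exists>f\<in>E. \<forall>x. \<bar>apply_bcontfun f x - apply_bcontfun g x\<bar> \<le> e"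
  shows "closure E = UNIV"
proof (intro set_eqI iffI)
  fix g :: "'a \<Rightarrow>\<^sub>C real"
  show "g \<in> closure E"
    unfolding closure_approachable
  proof (intro allI impI)
    fix e :: real assume "e > 0"
    then obtain f where f: "f \<in> E" "\<And>x. \<bar>apply_bcontfun f x - apply_bcontfun g x\<bar> \<le> e / 2"
      using assms[of "e/2" g] by auto
    have "dist f g \<le> e / 2"
      by (rule dist_bound) (use f in \<open>simp add: dist_real_def\<close>)
    then show "\<exists>f\<in>E. dist f g < e" using f \<open>e > 0\<close> by (intro bexI[of _ f]) auto
  qed
qed simp

lemma bcontfun_compact:
  fixes f :: "'a::topological_space \<Rightarrow> 'b::metric_space"
  assumes "compact (UNIV :: 'a set)" "continuous_on UNIV f"
  obtains F where "apply_bcontfun F = f"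
proof -
  have "f \<in> bcontfun"
    using assms compact_imp_bounded[OF compact_continuous_image[OF assms(2,1)]]
    by (simp add: bcontfun_def)
  then show ?thesis using that by (metis bcontfunE)
qed

section \<open>Functions that separate distant points\<close>

text \<open>This will supply distinct values for the pieces of a partition. Each new value has to
  avoid finitely many earlier ones inside a nondegenerate interval.\<close>

lemma inj_on_perturbation:
  fixes c :: "nat \<Rightarrow> real"
  assumes "e > 0"
  obtains v where "inj_on v {..<n}" "\<And>i. i < n \<Longrightarrow> \<bar>v i - c i\<bar> < e"
proof -
  have "\<exists>v. inj_on v {..<n} \<and> (\<forall>i<n. \<bar>v i - c i\<bar> < e)"
  proof (induction n)
    case (Suc n)
    then obtain v where v: "inj_on v {..<n}" "\<And>i. i < n \<Longrightarrow> \<bar>v i - c i\<bar> < e" by blast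
    have "infinite ({c n - e<..<c n + e} - v ` {..<n})"
      using assms by (intro Diff_infinite_finite) auto
    then obtain w where w: "w \<in> {c n - e<..<c n + e}" "w \<notin> v ` {..<n}"
      by (metis Diff_iff ex_in_conv finite.emptyI)
    have "inj_on (v(n := w)) {..<Suc n}"
      using v w by (auto simp: lessThan_Suc inj_on_def)
    moreover have "\<forall>i<Suc n. \<bar>(v(n := w)) i - c i\<bar> < e"
      using v w by (auto simp: less_Suc_eq)
    ultimately show ?case by blast
  qed simp
  then show ?thesis using that by blast
qed

text \<open>The pairs in \<open>C\<close> at distance at least \<open>\<delta>\<close> form a
  compact set, on which the difference of the two values of \<open>f\<close> has a positive lower
  bound \<open>e\<close>. A perturbation by less than \<open>e / 2\<close> changes each difference
  by less than \<open>e\<close>, so no such pair is identified.\<close>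

lemma open_separating_functions:
  fixes C :: "'a::metric_space set"
  assumes "compact C"
  shows "open {f :: 'a \<Rightarrow>\<^sub>C real. \<forall>x\<in>C. \<forall>y\<in>C. dist x y \<ge> \<delta> \<longrightarrow> apply_bcontfun f x \<noteq> apply_bcontfun f y}"
    (is "open ?E")
  unfolding open_dist
proof
  fix f assume f: "f \<in> ?E"
  define P where "P = {p \<in> C \<times> C. dist (fst p) (snd p) \<ge> \<delta>}"
  define h where "h p = \<bar>apply_bcontfun f (fst p) - apply_bcontfun f (snd p)\<bar>" for p
  have "P = (C \<times> C) \<inter> {p. dist (fst p) (snd p) \<ge> \<delta>}" by (auto simp: P_def)
  moreover have "closed {p :: 'a \<times> 'a. dist (fst p) (snd p) \<ge> \<delta>}"
    by (intro closed_Collect_le continuous_intros)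
  ultimately have cP: "compact P"
    using assms by (metis compact_Int_closed compact_Times)
  have cf: "continuous_on S (\<lambda>p. apply_bcontfun f (g p))" if "continuous_on S g" for g and S :: "('a \<times> 'a) set"
    by (rule continuous_on_compose2[OF continuous_on_apply_bcontfun[of UNIV] that]) simp
  have "\<exists>e>0. \<forall>p\<in>P. e \<le> h p"
  proof (cases "P = {}")
    case False
    have "continuous_on P h"
      unfolding h_def by (intro continuous_intros cf)
    then obtain p where p: "p \<in> P" "\<And>q. q \<in> P \<Longrightarrow> h p \<le> h q"
      using continuous_attains_inf[OF cP False] by blast
    moreover have "h p > 0" using p(1) f by (auto simp: h_def P_def)
    ultimately show ?thesis by blast
  qed (auto intro: exI[of _ 1])
  then obtain e where e: "e > 0" "\<And>p. p \<in> P \<Longrightarrow> e \<le> h p" by blast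
  have "g \<in> ?E" if "dist g f < e / 2" for g
  proof (clarsimp)
    fix x y assume xy: "x \<in> C" "y \<in> C" "\<delta> \<le> dist x y" "apply_bcontfun g x = apply_bcontfun g y"
    have "\<bar>apply_bcontfun g z - apply_bcontfun f z\<bar> < e / 2" for z
      using dist_fun_lt_imp_dist_val_lt[OF that, of z] by (simp add: dist_real_def)
    from this[of x] this[of y] have "h (x, y) < e" unfolding h_def fst_conv snd_conv xy(4) by linarith
    with e(2)[of "(x, y)"] xy show False by (simp add: P_def)
  qed
  then show "\<exists>e>0. \<forall>g. dist g f < e \<longrightarrow> g \<in> ?E"
    using e(1) by (intro exI[of _ "e / 2"]) auto
qed

text \<open>Near any function there is one that takes finitely many values on \<open>C\<close>, with distinct values
  on distinct pieces of a partition of \<open>C\<close> into small relatively clopen sets. The pieces come from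
  a finite cover by sets whose frontiers miss \<open>C\<close>.\<close>

lemma dense_separating_functions:
  fixes C :: "'a::metric_space set"
  assumes cU: "compact (UNIV :: 'a set)" and C: "closed C" and \<delta>: "\<delta> > 0"
    and base: "\<And>x V. open V \<Longrightarrow> x \<in> V \<Longrightarrow> \<exists>U. open U \<and> x \<in> U \<and> U \<subseteq> V \<and> frontier U \<inter> C = {}"
  shows "closure {f :: 'a \<Rightarrow>\<^sub>C real. \<forall>x\<in>C. \<forall>y\<in>C. dist x y \<ge> \<delta> \<longrightarrow> apply_bcontfun f x \<noteq> apply_bcontfun f y} = UNIV"
    (is "closure ?E = UNIV")
proof (rule dense_bcontfunI)
  fix g :: "'a \<Rightarrow>\<^sub>C real" and e :: real assume e: "e > 0"
  \<comment> \<open>Radius \<open>\<delta> / 2\<close> puts points of a common piece less than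
    \<open>\<delta>\<close> apart. The oscillation \<open>e / 2\<close> of \<open>g\<close> leaves
    another \<open>e / 2\<close> for making the values distinct.\<close>
  have "\<exists>U. open U \<and> p \<in> U \<and> U \<subseteq> ball p (\<delta> / 2) \<inter> {x. \<bar>apply_bcontfun g x - apply_bcontfun g p\<bar> < e / 2} \<and>
      frontier U \<inter> C = {}" for p
  proof (rule base)
    show "open (ball p (\<delta> / 2) \<inter> {x. \<bar>apply_bcontfun g x - apply_bcontfun g p\<bar> < e / 2})"
      by (intro open_Int open_ball open_Collect_less continuous_intros) auto
  qed (use \<delta> e in auto)
  then obtain U where U: "\<And>p. open (U p)" "\<And>p. p \<in> U p" "\<And>p. U p \<subseteq> ball p (\<delta> / 2)"
      "\<And>p x. x \<in> U p \<Longrightarrow> \<bar>apply_bcontfun g x - apply_bcontfun g p\<bar> < e / 2"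
      "\<And>p. frontier (U p) \<inter> C = {}"
    by (metis (no_types, lifting) le_inf_iff mem_Collect_eq subset_iff)
  obtain F where F: "finite F" "UNIV \<subseteq> (\<Union>p\<in>F. U p)"
    using compactE_image[OF cU, of UNIV U] U by (metis UNIV_I UN_I subsetI)
  obtain p :: "nat \<Rightarrow> 'a" and n where Fp: "F = p ` {..<n}"
    using finite_imp_nat_seg_image_inj_on[OF F(1)] by (auto simp: lessThan_def)
  have cover: "\<exists>i<n. x \<in> U (p i)" for x
    using F(2) Fp by auto
  obtain v where v: "inj_on v {..<n}" "\<And>i. i < n \<Longrightarrow> \<bar>v i - apply_bcontfun g (p i)\<bar> < e / 2"
    using inj_on_perturbation[of "e / 2" n "\<lambda>i. apply_bcontfun g (p i)"] e by auto
  \<comment> \<open>Taking the first member of the cover that contains a point turns the cover into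
    a partition.\<close>
  define idx where "idx x = (LEAST i. x \<in> U (p i))" for x
  have idx: "x \<in> U (p (idx x))" "idx x < n" for x
  proof -
    obtain i where i: "i < n" "x \<in> U (p i)" using cover by blast
    show "x \<in> U (p (idx x))" unfolding idx_def by (rule LeastI[of _ i]) (rule i)
    have "idx x \<le> i" unfolding idx_def by (rule Least_le) (rule i)
    then show "idx x < n" using i by simp
  qed
  \<comment> \<open>\<open>h\<close> is the correction that turns \<open>g\<close> into the step
    function on \<open>C\<close>. It is bounded by \<open>e\<close>, and the Tietze extension keeps
    this bound, so adding it to \<open>g\<close> stays within \<open>e\<close> of \<open>g\<close>
    on the whole space.\<close>
  define h where "h x = v (idx x) - apply_bcontfun g x" for x
  have habs: "\<bar>h x\<bar> \<le> e" for x
    using v(2)[OF idx(2)[of x]] U(4)[OF idx(1)[of x]] unfolding h_def by linarith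
  \<comment> \<open>A point of \<open>C\<close> lies on no frontier, so it is interior to each cover
    member or to its complement. Membership in the finitely many members is thus locally constant on
    \<open>C\<close>, and so is the first index.\<close>
  have idx_const: "\<forall>\<^sub>F y in at x within C. idx y = idx x" if x: "x \<in> C" for x
  proof -
    have "\<forall>\<^sub>F y in at x within C. (y \<in> U (p i)) = (x \<in> U (p i))" for i
    proof (cases "x \<in> U (p i)")
      case True
      then have "\<forall>\<^sub>F y in at x within C. y \<in> U (p i)"
        using U(1) eventually_at_topological by blast
      then show ?thesis by eventually_elim (use True in auto)
    next
      case False
      then have "x \<in> - closure (U (p i))"
        using U(5)[of "p i"] x U(1) by (auto simp: frontier_def interior_open)
      then have "\<forall>\<^sub>F y in at x within C. y \<in> - closure (U (p i))"
        by (metis closed_closure eventually_at_topological open_Compl)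
      then show ?thesis by eventually_elim (use False closure_subset in auto)
    qed
    then have "\<forall>\<^sub>F y in at x within C. \<forall>i\<in>{..<n}. (y \<in> U (p i)) = (x \<in> U (p i))"
      by (intro eventually_ball_finite) auto
    then show ?thesis
    proof eventually_elim
      case (elim y)
      have "idx y \<le> idx x" "idx x \<le> idx y"
        using elim idx[of x] idx[of y] by (auto simp: idx_def intro!: Least_le)
      then show ?case by simp
    qed
  qed
  have "continuous_on C (\<lambda>x. v (idx x))"
    unfolding continuous_on_def
  proof
    fix x assume x: "x \<in> C"
    have "\<forall>\<^sub>F y in at x within C. v (idx y) = v (idx x)"
      by (rule eventually_mono[OF idx_const[OF x]]) simp
    then show "((\<lambda>x. v (idx x)) \<longlongrightarrow> v (idx x)) (at x within C)"
      by (rule tendsto_eventually)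
  qed
  then have "continuous_on C h"
    unfolding h_def by (intro continuous_on_diff) auto
  then have "continuous_map (subtopology euclidean C) euclideanreal h"
    by simp
  moreover have "h ` C \<subseteq> {-e..e}" using habs by (auto simp: abs_le_iff minus_le_iff)
  moreover have "normal_space (euclidean :: 'a topology)"
    using metrizable_imp_normal_space metrizable_space_euclidean by blast
  ultimately obtain k where k: "continuous_on UNIV k" "\<And>x. x \<in> C \<Longrightarrow> k x = h x" "range k \<subseteq> {-e..e}"
    using Tietze_extension_closed_real_interval[of euclidean C h "-e" e] C e by auto
  have "continuous_on UNIV (\<lambda>x. apply_bcontfun g x + k x)"
    using k(1) by (intro continuous_on_add) auto
  then obtain f where f: "apply_bcontfun f = (\<lambda>x. apply_bcontfun g x + k x)"
    using bcontfun_compact[OF cU] by blast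
  have "f \<in> ?E"
  proof clarify
    fix x y assume xy: "x \<in> C" "y \<in> C" "\<delta> \<le> dist x y" "apply_bcontfun f x = apply_bcontfun f y"
    then have "v (idx x) = v (idx y)" by (simp add: f k(2) h_def)
    then have "idx x = idx y" using v(1) idx(2) by (auto dest: inj_onD)
    then have "x \<in> ball (p (idx x)) (\<delta> / 2)" "y \<in> ball (p (idx x)) (\<delta> / 2)"
      using U(3) idx(1) by (metis subsetD)+
    then have "dist x y < \<delta>"
      using dist_triangle_half_r[of "p (idx x)" x \<delta> y] by simp
    with xy(3) show False by simp
  qed
  moreover have "\<bar>apply_bcontfun f x - apply_bcontfun g x\<bar> \<le> e" for x
  proof -
    have "k x \<in> {-e..e}" using k(3) by blast
    then show ?thesis by (simp add: f abs_le_iff)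
  qed
  ultimately show "\<exists>f\<in>?E. \<forall>x. \<bar>apply_bcontfun f x - apply_bcontfun g x\<bar> \<le> e" by blast
qed

text \<open>If the sublevel set of \<open>f\<close> within a small ball around \<open>x\<close> stays away from the frontier of
  the ball, then its frontier is contained in a level set of \<open>f\<close>.\<close>

lemma dense_level_sets_large_dim:
  fixes x :: "'a::metric_space"
  assumes cU: "compact (UNIV :: 'a set)" and "open V" "x \<in> V"
    and large: "\<And>U. open U \<Longrightarrow> x \<in> U \<Longrightarrow> U \<subseteq> V \<Longrightarrow> hausdorff_dim (frontier U) \<ge> c"
  shows "closure (interior {f :: 'a \<Rightarrow>\<^sub>C real.
    \<exists>a b. a < b \<and> (\<forall>y\<in>{a..b}. hausdorff_dim (apply_bcontfun f -` {y}) \<ge> c)}) = UNIV"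
    (is "closure (interior ?T) = UNIV")
proof (rule dense_bcontfunI)
  fix g :: "'a \<Rightarrow>\<^sub>C real" and e :: real assume e: "e > 0"
  have "open (V \<inter> {z. \<bar>apply_bcontfun g z - apply_bcontfun g x\<bar> < e / 4})"
    using assms(2) by (intro open_Int open_Collect_less continuous_intros) auto
  then obtain r where r: "r > 0"
      "cball x r \<subseteq> V \<inter> {z. \<bar>apply_bcontfun g z - apply_bcontfun g x\<bar> < e / 4}"
    using assms(3) e unfolding open_contains_cball by force
  \<comment> \<open>A conical pit of depth \<open>e\<close> at \<open>x\<close> that vanishes at
    distance \<open>r\<close>.\<close>
  define k where "k z = apply_bcontfun g z - e * max 0 (1 - dist x z / r)" for z
  have "continuous_on UNIV k"
    unfolding k_def using r by (intro continuous_intros) auto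
  then obtain f where f: "apply_bcontfun f = k"
    using bcontfun_compact[OF cU] by blast
  have "f' \<in> ?T" if "dist f' f < e / 8" for f'
  proof -
    \<comment> \<open>The levels separate centre from rim for every \<open>f'\<close> within
      \<open>e / 8\<close> of \<open>f\<close>. Relative to the value of \<open>g\<close> at
      \<open>x\<close>, \<open>f'\<close> is below -7e/8 at \<open>x\<close> and above -3e/8 at
      distance \<open>r\<close>, and the levels run from -3e/4 to -e/2 in between.\<close>
    define a where "a = apply_bcontfun g x - e * 3 / 4"
    define b where "b = apply_bcontfun g x - e / 2"
    have near: "\<bar>apply_bcontfun f' z - k z\<bar> < e / 8" for z
      using dist_fun_lt_imp_dist_val_lt[OF that, of z] by (simp add: dist_real_def f)
    have "hausdorff_dim (apply_bcontfun f' -` {y}) \<ge> c" if y: "y \<in> {a..b}" for y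
    proof -
      define U where "U = ball x r \<inter> {z. apply_bcontfun f' z < y}"
      have "open U"
        unfolding U_def by (intro open_Int open_Collect_less continuous_intros) auto
      moreover have "x \<in> U"
      proof -
        have "k x = apply_bcontfun g x - e" by (simp add: k_def)
        then have "apply_bcontfun f' x < a" using near[of x] e unfolding a_def by linarith
        then show ?thesis using r y by (simp add: U_def)
      qed
      moreover have "U \<subseteq> V" using r by (auto simp: U_def)
      ultimately have "c \<le> hausdorff_dim (frontier U)" by (rule large)
      also have "frontier U \<subseteq> apply_bcontfun f' -` {y}"
      proof
        fix z assume z: "z \<in> frontier U"
        then have zU: "z \<in> closure U" "z \<notin> U"
          using \<open>open U\<close> by (auto simp: frontier_def interior_open)
        have "closed (cball x r \<inter> {z. apply_bcontfun f' z \<le> y})"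
          by (intro closed_Int closed_cball closed_Collect_le continuous_intros) auto
        then have "closure U \<subseteq> cball x r \<inter> {z. apply_bcontfun f' z \<le> y}"
          by (intro closure_minimal) (auto simp: U_def)
        then have z': "dist x z \<le> r" "apply_bcontfun f' z \<le> y" using zU by auto
        have "dist x z \<noteq> r"
        proof
          assume "dist x z = r"
          then have "k z = apply_bcontfun g z" "\<bar>apply_bcontfun g z - apply_bcontfun g x\<bar> < e / 4"
            using r by (auto simp: k_def)
          moreover have "y \<le> b" using y by simp
          ultimately show False using near[of z] z'(2) e unfolding b_def by linarith
        qed
        then show "z \<in> apply_bcontfun f' -` {y}" using z' zU(2) by (auto simp: U_def)
      qed
      then have "hausdorff_dim (frontier U) \<le> hausdorff_dim (apply_bcontfun f' -` {y})"
        by (rule hausdorff_dim_mono)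
      finally show ?thesis .
    qed
    moreover have "a < b" using e by (simp add: a_def b_def)
    ultimately show ?thesis by blast
  qed
  then have "ball f (e / 8) \<subseteq> ?T" by (auto simp: dist_commute)
  then have "f \<in> interior ?T"
    using e by (intro interiorI[OF open_ball]) auto
  moreover have "\<bar>apply_bcontfun f z - apply_bcontfun g z\<bar> \<le> e" for z
    using r e mult_left_mono[of "max 0 (1 - dist x z / r)" 1 e] by (auto simp: f k_def abs_mult)
  ultimately show "\<exists>f\<in>interior ?T. \<forall>x. \<bar>apply_bcontfun f x - apply_bcontfun g x\<bar> \<le> e" by blast
qed

section \<open>Topological Hausdorff dimension\<close>

lemma top_hausdorff_dim_less:
  assumes "top_hausdorff_dim (UNIV :: 'a::metric_space set) < e"
  obtains d and \<B> :: "'a::metric_space set set" where "d < e" "base_of \<B> euclidean"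
    "\<And>U. U \<in> \<B> \<Longrightarrow> hausdorff_dim (frontier U) \<le> d - 1"
  using assms by (auto simp: top_hausdorff_dim_def Inf_less_iff)

text \<open>Nonempty sets have Hausdorff dimension at least 0. A value below 1 would therefore give
  a base with empty frontiers, that is, of clopen sets, and the small inductive dimension would be
  at most 0.\<close>

lemma top_hausdorff_dim_ge_1:
  assumes "small_ind_dim (euclidean :: 'a::metric_space topology) > 0"
  shows "top_hausdorff_dim (UNIV :: 'a set) \<ge> 1"
proof (rule ccontr)
  assume "\<not> ?thesis"
  then have "top_hausdorff_dim (UNIV :: 'a set) < 1" by simp
  then obtain d and \<B> :: "'a set set" where d: "d < 1" and B: "base_of \<B> euclidean"
    "\<And>U. U \<in> \<B> \<Longrightarrow> hausdorff_dim (frontier U) \<le> d - 1"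
    by (rule top_hausdorff_dim_less) blast
  have "d - 1 < 0" using d by (cases d) (auto simp: one_ereal_def)
  then have "frontier U = {}" if "U \<in> \<B>" for U
    using B(2)[OF that] hausdorff_dim_nonneg[of "frontier U"] by (meson leD order_le_less_trans)
  then have "\<forall>U\<in>\<B>. small_ind_dim (subtopology euclidean (euclidean frontier_of U)) \<le> 0 - 1"
    by (simp add: small_ind_dim_empty)
  then have "small_ind_dim (euclidean :: 'a topology) \<le> 0"
    using B(1) by (subst small_ind_dim_rec) (auto intro!: Inf_lower)
  with assms show False by simp
qed

lemma base_of_euclidean_iff:
  "base_of \<B> euclidean \<longleftrightarrow>
     (\<forall>U\<in>\<B>. open U) \<and> (\<forall>V x. open V \<and> x \<in> V \<longrightarrow> (\<exists>U\<in>\<B>. x \<in> U \<and> U \<subseteq> V))"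
  by (simp add: base_of_iff)

section \<open>Countable bases with null frontiers\<close>

text \<open>The countable base has to consist of members of \<open>\<B>\<close>, so that bounds on
  their frontiers persist. By compactness, finitely many members contained in balls of radius
  1/(n+1) cover the space; these finite covers together form a base.\<close>

lemma countable_subbase:
  fixes \<B> :: "'a::metric_space set set"
  assumes cU: "compact (UNIV :: 'a set)" and B: "base_of \<B> euclidean"
  obtains \<C> where "countable \<C>" "\<C> \<subseteq> \<B>" "base_of \<C> euclidean"
proof -
  have "\<exists>\<F>\<subseteq>\<B>. finite \<F> \<and> UNIV \<subseteq> \<Union>\<F> \<and> (\<forall>U\<in>\<F>. \<exists>x. U \<subseteq> ball x (inverse (Suc n)))" for n
  proof -
    let ?S = "{U \<in> \<B>. \<exists>x. U \<subseteq> ball x (inverse (Suc n))}"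
    have "UNIV \<subseteq> \<Union>?S"
    proof
      fix x :: 'a
      have "open (ball x (inverse (Suc n)))" "x \<in> ball x (inverse (Suc n))" by auto
      then obtain U where "U \<in> \<B>" "x \<in> U" "U \<subseteq> ball x (inverse (Suc n))"
        using B unfolding base_of_euclidean_iff by blast
      then show "x \<in> \<Union>?S" by blast
    qed
    moreover have "\<And>U. U \<in> ?S \<Longrightarrow> open U" using B by (auto simp: base_of_euclidean_iff)
    ultimately obtain \<F> where "\<F> \<subseteq> ?S" "finite \<F>" "UNIV \<subseteq> \<Union>\<F>"
      by (rule compactE[OF cU])
    then show ?thesis by (intro exI[of _ \<F>]) auto
  qed
  then obtain \<F> where F: "\<And>n. \<F> n \<subseteq> \<B>" "\<And>n. finite (\<F> n)" "\<And>n. UNIV \<subseteq> \<Union>(\<F> n)"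
    "\<And>n U. U \<in> \<F> n \<Longrightarrow> \<exists>x. U \<subseteq> ball x (inverse (Suc n))"
    by metis
  have "base_of (\<Union>n. \<F> n) euclidean"
    unfolding base_of_euclidean_iff
  proof (intro conjI allI impI ballI)
    fix U assume "U \<in> (\<Union>n. \<F> n)"
    then show "open U" using F(1) B by (auto simp: base_of_euclidean_iff)
  next
    fix V and x :: 'a assume "open V \<and> x \<in> V"
    then obtain e where e: "e > 0" "ball x e \<subseteq> V" by (auto simp: open_contains_ball)
    obtain n where n: "inverse (real (Suc n)) < e / 2"
      using reals_Archimedean[of "e / 2"] e by auto
    obtain U where U: "U \<in> \<F> n" "x \<in> U" using F(3) by blast
    then obtain p where p: "U \<subseteq> ball p (inverse (Suc n))" using F(4) by blast
    have "U \<subseteq> ball x e"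
    proof
      fix z assume "z \<in> U"
      then have "dist p z < inverse (Suc n)" "dist p x < inverse (Suc n)"
        using p U(2) by (meson mem_ball subsetD)+
      then have "dist p z < e / 2" "dist p x < e / 2" using n by linarith+
      then show "z \<in> ball x e" using dist_triangle_half_r by auto
    qed
    then show "\<exists>U\<in>\<Union>n. \<F> n. x \<in> U \<and> U \<subseteq> V" using U e by blast
  qed
  moreover have "countable (\<Union>n. \<F> n)" using F(2) by (simp add: countable_finite)
  ultimately show ?thesis using that F(1) by blast
qed

lemma null_frontier_base:
  assumes cU: "compact (UNIV :: 'a::metric_space set)"
    and q: "top_hausdorff_dim (UNIV :: 'a set) < ereal q"
  obtains \<B> :: "'a::metric_space set set" where "countable \<B>" "base_of \<B> euclidean"
    "\<And>U. U \<in> \<B> \<Longrightarrow> hausdorff_measure (q - 1) (frontier U) = 0"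
proof -
  obtain d and \<B> :: "'a set set" where d: "d < ereal q" and B: "base_of \<B> euclidean"
    "\<And>U. U \<in> \<B> \<Longrightarrow> hausdorff_dim (frontier U) \<le> d - 1"
    using q by (rule top_hausdorff_dim_less) blast
  obtain \<C> where C: "countable \<C>" "\<C> \<subseteq> \<B>" "base_of \<C> euclidean"
    using countable_subbase[OF cU B(1)] .
  have dq: "d - 1 < ereal (q - 1)" using d by (cases d) (auto simp: one_ereal_def)
  have "hausdorff_measure (q - 1) (frontier U) = 0" if "U \<in> \<C>" for U
    using B(2)[of U] C(2) that dq by (intro hausdorff_null_if_dim_less) (auto intro: le_less_trans)
  then show ?thesis using that[of \<C>] C by blast
qed

lemma top_hausdorff_dim_greater:
  assumes "d < top_hausdorff_dim (UNIV :: 'a::metric_space set)"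
  obtains x and V :: "'a::metric_space set" where "open V" "x \<in> V"
    "\<And>U. open U \<Longrightarrow> x \<in> U \<Longrightarrow> U \<subseteq> V \<Longrightarrow> hausdorff_dim (frontier U) \<ge> d - 1"
proof -
  let ?B = "{U :: 'a set. open U \<and> hausdorff_dim (frontier U) \<le> d - 1}"
  have "\<not> base_of ?B euclidean"
  proof
    assume "base_of ?B euclidean"
    then have "top_hausdorff_dim (UNIV :: 'a set) \<le> d"
      unfolding top_hausdorff_dim_def by (auto intro!: Inf_lower exI[of _ ?B])
    with assms show False by simp
  qed
  then obtain V x where V: "open V" "x \<in> V" "\<not> (\<exists>U\<in>?B. x \<in> U \<and> U \<subseteq> V)"
    unfolding base_of_euclidean_iff by blast
  have "hausdorff_dim (frontier U) \<ge> d - 1" if "open U" "x \<in> U" "U \<subseteq> V" for U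
  proof (rule ccontr)
    assume "\<not> ?thesis"
    with that V(3) show False by (auto simp: not_le less_imp_le)
  qed
  then show ?thesis by (rule that[OF V(1,2)])
qed

text \<open>The sets \<open>W q\<close> collecting the frontiers of all bases with exponent at most \<open>q\<close> increase with \<open>q\<close>.
  Hence the complements of any two of the open sets miss the frontiers of a common base, so no sum
  theorem for zero-dimensional sets is needed.\<close>

lemma null_open_hulls:
  assumes cU: "compact (UNIV :: 'a::metric_space set)"
    and D1: "top_hausdorff_dim (UNIV :: 'a set) \<ge> 1"
  defines "Q \<equiv> {q :: rat. top_hausdorff_dim (UNIV :: 'a set) < ereal (of_rat q)}"
  shows "\<exists>(H :: rat \<Rightarrow> nat \<Rightarrow> 'a set) p. \<forall>q\<in>Q. (\<forall>n. open (H q n) \<and> p \<in> H q n) \<and>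
    hausdorff_measure (of_rat q - 1) (\<Inter>n. H q n) = 0 \<and>
    (\<forall>r\<in>Q. \<forall>m n. \<exists>\<B>. base_of \<B> euclidean \<and> (\<forall>U\<in>\<B>. frontier U \<inter> (- H q m \<union> - H r n) = {}))"
proof -
  \<comment> \<open>Positive exponents allow both the insertion of a point and the passage to open
    hulls.\<close>
  have Q1: "of_rat q - 1 > (0 :: real)" if "q \<in> Q" for q
  proof -
    have "top_hausdorff_dim (UNIV :: 'a set) < ereal (of_rat q)" using that by (simp add: Q_def)
    then have "1 < ereal (of_rat q)" by (rule le_less_trans[OF D1])
    then show ?thesis by (simp add: one_ereal_def)
  qed
  have "\<exists>\<B> :: 'a set set. countable \<B> \<and> base_of \<B> euclidean \<and>
      (\<forall>U\<in>\<B>. hausdorff_measure (of_rat q - 1) (frontier U) = 0)" if "q \<in> Q" for q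
    using null_frontier_base[OF cU, of "of_rat q"] that unfolding Q_def by (metis mem_Collect_eq)
  then obtain \<B> :: "rat \<Rightarrow> 'a set set" where B: "\<And>q. q \<in> Q \<Longrightarrow> countable (\<B> q)"
      "\<And>q. q \<in> Q \<Longrightarrow> base_of (\<B> q) euclidean"
      "\<And>q U. q \<in> Q \<Longrightarrow> U \<in> \<B> q \<Longrightarrow> hausdorff_measure (of_rat q - 1) (frontier U) = 0"
    by metis
  obtain p :: 'a where True by blast
  \<comment> \<open>The extra point \<open>p\<close> ends up in the set \<open>G\<close> of the
    theorem and keeps it nonempty. If the dimension is 1, an empty \<open>G\<close> would have
    dimension -1 where 0 is required.\<close>
  define W where "W q = insert p (\<Union>U\<in>(\<Union>t\<in>{t\<in>Q. t \<le> q}. \<B> t). frontier U)" for q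
  have null: "hausdorff_measure (of_rat q - 1) (W q) = 0" if q: "q \<in> Q" for q
  proof -
    have fr: "hausdorff_measure (of_rat q - 1) (frontier U) = 0"
      if "t \<in> Q" "t \<le> q" "U \<in> \<B> t" for t U
    proof (rule hausdorff_null_mono_exponent)
      show "hausdorff_measure (of_rat t - 1) (frontier U) = 0" by (rule B(3)[OF that(1,3)])
      show "0 \<le> of_rat t - (1 :: real)" using Q1[OF that(1)] by (rule less_imp_le)
      show "of_rat t - 1 \<le> of_rat q - (1 :: real)" using that(2) by (simp add: of_rat_less_eq)
    qed
    have "countable (frontier ` (\<Union>t\<in>{t\<in>Q. t \<le> q}. \<B> t))"
      using B(1) by (intro countable_image countable_UN) auto
    then have "hausdorff_measure (of_rat q - 1) (\<Union>U\<in>(\<Union>t\<in>{t\<in>Q. t \<le> q}. \<B> t). frontier U) = 0"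
      by (rule hausdorff_null_Union) (use fr in blast)
    then show ?thesis unfolding W_def using Q1[OF q] by (rule hausdorff_null_insert)
  qed
  have "\<exists>H :: nat \<Rightarrow> 'a set. (\<forall>n. open (H n) \<and> W q \<subseteq> H n) \<and>
      hausdorff_measure (of_rat q - 1) (\<Inter>n. H n) = 0" if "q \<in> Q" for q
    by (rule hausdorff_null_open_hull[OF null[OF that] Q1[OF that]]) blast
  then obtain H :: "rat \<Rightarrow> nat \<Rightarrow> 'a set" where H: "\<And>q n. q \<in> Q \<Longrightarrow> open (H q n)"
      "\<And>q n. q \<in> Q \<Longrightarrow> W q \<subseteq> H q n"
      "\<And>q. q \<in> Q \<Longrightarrow> hausdorff_measure (of_rat q - 1) (\<Inter>n. H q n) = 0"
    by metis
  have "\<exists>\<B>. base_of \<B> euclidean \<and> (\<forall>U\<in>\<B>. frontier U \<inter> (- H q m \<union> - H r n) = {})"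
    if qr: "q \<in> Q" "r \<in> Q" for q r m n
  proof (intro exI conjI ballI)
    have mQ: "min q r \<in> Q" using qr by (simp add: min_def)
    show "base_of (\<B> (min q r)) euclidean" using B(2)[OF mQ] .
    fix U assume "U \<in> \<B> (min q r)"
    then have "frontier U \<subseteq> W q" "frontier U \<subseteq> W r"
      using mQ unfolding W_def by (blast intro: min.cobounded1 min.cobounded2)+
    then show "frontier U \<inter> (- H q m \<union> - H r n) = {}" using H(2) qr by blast
  qed
  moreover have "p \<in> H q n" if "q \<in> Q" for q n
    using H(2)[OF that] by (auto simp: W_def)
  ultimately show ?thesis using H(1,3) by (intro exI[of _ H] exI[of _ p]) simp
qed

section \<open>The generic function\<close>

text \<open>Injectivity off \<open>G\<close> leaves at most one point of a level set outside
  \<open>G\<close>, and one more point does not affect nullity for a positive exponent.\<close>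

lemma hausdorff_null_vimage_singleton:
  assumes "inj_on f (- G)" and null: "hausdorff_measure s G = 0" and "s > 0"
  shows "hausdorff_measure s (f -` {y}) = 0"
proof (cases "f -` {y} \<subseteq> G")
  case True
  with null show ?thesis by (rule hausdorff_null_subset)
next
  case False
  then obtain z where "f z = y" "z \<notin> G" by auto
  then have "f -` {y} \<subseteq> insert z G" using assms(1) by (auto simp: inj_on_def)
  with hausdorff_null_insert[OF null \<open>s > 0\<close>] show ?thesis by (rule hausdorff_null_subset)
qed

theorem theorem7p13:
  assumes "compact (UNIV :: 'a::metric_space set)"
    and "small_ind_dim (euclidean :: 'a topology) > 0"
  shows "\<exists>G :: 'a set.
    gdelta_in euclidean G \<and>
    hausdorff_dim G = top_hausdorff_dim (UNIV :: 'a set) - 1 \<and>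
    comeager {f :: 'a \<Rightarrow>\<^sub>C real.
      inj_on (apply_bcontfun f) (UNIV - G) \<and>
      (\<forall>y. hausdorff_dim (apply_bcontfun f -` {y}) \<le> top_hausdorff_dim (UNIV :: 'a set) - 1) \<and>
      (\<forall>d :: ereal. d < top_hausdorff_dim (UNIV :: 'a set) \<longrightarrow>
         (\<exists>a b. a < b \<and>
            (\<forall>y\<in>{a..b}. hausdorff_dim (apply_bcontfun f -` {y}) \<ge> d - 1)))}"
proof -
  define D where "D = top_hausdorff_dim (UNIV :: 'a set)"
  have D1: "D \<ge> 1" unfolding D_def using assms(2) by (rule top_hausdorff_dim_ge_1)
  then have D0: "0 \<le> D - 1" by (cases D) (auto simp: one_ereal_def)
  define Q where "Q = {q :: rat. D < ereal (of_rat q)}"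
  obtain H :: "rat \<Rightarrow> nat \<Rightarrow> 'a set" and p where "\<forall>q\<in>Q. (\<forall>n. open (H q n) \<and> p \<in> H q n) \<and>
    hausdorff_measure (of_rat q - 1) (\<Inter>n. H q n) = 0 \<and>
    (\<forall>r\<in>Q. \<forall>m n. \<exists>\<B>. base_of \<B> euclidean \<and> (\<forall>U\<in>\<B>. frontier U \<inter> (- H q m \<union> - H r n) = {}))"
    using null_open_hulls[OF assms(1) D1[unfolded D_def], folded D_def, folded Q_def]
    by (elim exE)
  then have H: "\<And>q n. q \<in> Q \<Longrightarrow> open (H q n)" "\<And>q n. q \<in> Q \<Longrightarrow> p \<in> H q n"
    "\<And>q. q \<in> Q \<Longrightarrow> hausdorff_measure (of_rat q - 1) (\<Inter>n. H q n) = 0"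
    "\<And>q r m n. q \<in> Q \<Longrightarrow> r \<in> Q \<Longrightarrow>
       \<exists>\<B>. base_of \<B> euclidean \<and> (\<forall>U\<in>\<B>. frontier U \<inter> (- H q m \<union> - H r n) = {})"
    by simp_all
  define G where "G = (\<Inter>q\<in>Q. \<Inter>n. H q n)"
  have "gdelta_in euclidean G"
  \<comment> \<open>\<open>Q\<close> is empty exactly when \<open>D\<close> is \<infinity>; then
    \<open>G\<close> is the whole space.\<close>
  proof (cases "Q = {}")
    case False
    then have "gdelta_in euclidean (\<Inter>((\<lambda>(q, n). H q n) ` (Q \<times> UNIV)))"
      using H(1) by (intro gdelta_in_Inter) (auto intro!: open_imp_gdelta_in)
    also have "\<Inter>((\<lambda>(q, n). H q n) ` (Q \<times> UNIV)) = G" by (auto simp: G_def)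
    finally show ?thesis .
  qed (simp add: G_def open_imp_gdelta_in)

  have nullG: "hausdorff_measure s G = 0" if s: "D - 1 < ereal s" for s
  proof -
    have "D < ereal (s + 1)" using s by (cases D) (auto simp: one_ereal_def)
    \<comment> \<open>For such a \<open>q\<close> the exponent \<open>q - 1\<close> is at most
      \<open>s\<close>, and \<open>G\<close> lies in the null hull belonging to
      \<open>q\<close>.\<close>
    then obtain q :: rat where q: "D < ereal (of_rat q)" "ereal (of_rat q) < ereal (s + 1)"
      using ereal_dense3 by blast
    have "1 < ereal (of_rat q)" using D1 q(1) by (rule le_less_trans)
    then have "0 \<le> of_rat q - (1 :: real)" by (simp add: one_ereal_def)
    moreover have "q \<in> Q" using q by (simp add: Q_def)
    then have "hausdorff_measure (of_rat q - 1) G = 0"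
      using H(3) by (auto simp: G_def intro: hausdorff_null_subset)
    ultimately show ?thesis using q(2) by (elim hausdorff_null_mono_exponent) auto
  qed

  define sep where "sep C k = {f :: 'a \<Rightarrow>\<^sub>C real. \<forall>x\<in>C. \<forall>y\<in>C.
      dist x y \<ge> inverse (Suc k) \<longrightarrow> apply_bcontfun f x \<noteq> apply_bcontfun f y}" for C and k :: nat
  define thick where "thick c = {f :: 'a \<Rightarrow>\<^sub>C real.
      \<exists>a b. a < b \<and> (\<forall>y\<in>{a..b}. hausdorff_dim (apply_bcontfun f -` {y}) \<ge> c)}" for c
  \<comment> \<open>Countably many conditions suffice. The closed sets \<open>- H q m\<close> cover
    the complement of \<open>G\<close>, so two distinct points of it lie in the union of two of them
    and are more than 1/(k+1) apart for some \<open>k\<close>. For the level sets, rational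
    \<open>q\<close> below \<open>D\<close> are enough, since one lies above any given
    \<open>d < D\<close>.\<close>
  define \<E> where "\<E> = (\<lambda>((q, m), (r, n), k). sep (- H q m \<union> - H r n) k) ` ((Q \<times> UNIV) \<times> (Q \<times> UNIV) \<times> UNIV)
      \<union> (\<lambda>q. interior (thick (ereal (of_rat q) - 1))) ` {q :: rat. ereal (of_rat q) < D}"
  have cE: "countable \<E>" unfolding \<E>_def by simp
  have open_dense: "open E \<and> closure E = UNIV" if E: "E \<in> \<E>" for E
    using E unfolding \<E>_def
  proof (elim UnE imageE)
    fix z assume z: "E = (\<lambda>((q, m), (r, n), k). sep (- H q m \<union> - H r n) k) z"
      "z \<in> (Q \<times> UNIV) \<times> (Q \<times> UNIV) \<times> UNIV"
    obtain q m r n k where z': "z = ((q, m), (r, n), k)" by (metis prod.exhaust)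
    let ?C = "- H q m \<union> - H r n"
    have qr: "q \<in> Q" "r \<in> Q" and E': "E = sep ?C k" using z z' by auto
    have C: "closed ?C" using H(1) qr by auto
    then have "compact ?C" using compact_Int_closed[OF assms(1) C] by simp
    then have "open E" unfolding E' sep_def by (rule open_separating_functions)
    moreover obtain \<B> where "base_of \<B> euclidean" "\<forall>U\<in>\<B>. frontier U \<inter> ?C = {}"
      using H(4)[OF qr] by blast
    then have "\<exists>U. open U \<and> x \<in> U \<and> U \<subseteq> V \<and> frontier U \<inter> ?C = {}" if "open V" "x \<in> V" for V x
      using that unfolding base_of_euclidean_iff by meson
    then have "closure E = UNIV"
      unfolding E' sep_def by (intro dense_separating_functions assms(1) C) auto
    ultimately show ?thesis by simp
  next
    fix q :: rat assume q: "E = interior (thick (ereal (of_rat q) - 1))" "q \<in> {q. ereal (of_rat q) < D}"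
    then have "ereal (of_rat q) < top_hausdorff_dim (UNIV :: 'a set)" by (simp add: D_def)
    then obtain x and V :: "'a set" where "open V" "x \<in> V"
      "\<And>U. open U \<Longrightarrow> x \<in> U \<Longrightarrow> U \<subseteq> V \<Longrightarrow> hausdorff_dim (frontier U) \<ge> ereal (of_rat q) - 1"
      by (rule top_hausdorff_dim_greater) blast
    then have "closure E = UNIV"
      unfolding q(1) thick_def by (rule dense_level_sets_large_dim[OF assms(1)])
    then show ?thesis by (simp add: q(1))
  qed

  have injG: "inj_on (apply_bcontfun f) (- G)" if f: "f \<in> \<Inter>\<E>" for f
  proof (rule inj_onI, rule ccontr)
    fix x y assume xy: "x \<in> - G" "y \<in> - G" "apply_bcontfun f x = apply_bcontfun f y" "x \<noteq> y"
    obtain q m r n where qr: "q \<in> Q" "r \<in> Q" "x \<in> - H q m" "y \<in> - H r n"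
      using xy by (auto simp: G_def)
    obtain k where k: "inverse (real (Suc k)) < dist x y"
      using reals_Archimedean[of "dist x y"] xy(4) by auto
    have "sep (- H q m \<union> - H r n) k \<in> \<E>"
      unfolding \<E>_def using qr by (intro UnI1 image_eqI[of _ _ "((q, m), (r, n), k)"]) auto
    then have "f \<in> sep (- H q m \<union> - H r n) k" using f by blast
    then show False using qr k xy(3) unfolding sep_def by (auto dest!: less_imp_le)
  qed
  have thickE: "\<exists>a b. a < b \<and> (\<forall>y\<in>{a..b}. hausdorff_dim (apply_bcontfun f -` {y}) \<ge> d - 1)"
    if f: "f \<in> \<Inter>\<E>" and d: "d < D" for f d
  proof -
    obtain q :: rat where q: "d < ereal (of_rat q)" "ereal (of_rat q) < D"
      using ereal_dense3[OF d] by blast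
    have "interior (thick (ereal (of_rat q) - 1)) \<in> \<E>" using q unfolding \<E>_def by blast
    then have "f \<in> thick (ereal (of_rat q) - 1)" using f interior_subset by blast
    moreover have "d - 1 \<le> ereal (of_rat q) - 1" using q by (intro ereal_minus_mono) auto
    ultimately show ?thesis unfolding thick_def using order_trans by blast
  qed
  have levels: "hausdorff_dim (apply_bcontfun f -` {y}) \<le> D - 1" if f: "f \<in> \<Inter>\<E>" for f y
  proof (rule hausdorff_dim_le_if_null[OF D0])
    fix s assume s: "D - 1 < ereal s"
    then have "s > 0" using D0 by (metis ereal_less(2) le_less_trans)
    then show "hausdorff_measure s (apply_bcontfun f -` {y}) = 0"
      using hausdorff_null_vimage_singleton[OF injG[OF f] nullG[OF s]] by blast
  qed

  have "hausdorff_dim G = D - 1"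
  proof (rule antisym)
    show "hausdorff_dim G \<le> D - 1"
      by (rule hausdorff_dim_le_if_null[OF D0 nullG])
    show "D - 1 \<le> hausdorff_dim G"
    proof (rule ccontr)
      assume "\<not> ?thesis"
      \<comment> \<open>With dim \<open>G\<close> < \<open>s\<close> < \<open>t\<close> <
        \<open>D - 1\<close>, a function satisfying all conditions in \<open>\<E>\<close> would have
        a level set of dimension at least \<open>t\<close>, while injectivity off \<open>G\<close>
        bounds that dimension by \<open>s\<close>.\<close>
      then obtain s where s: "hausdorff_dim G < ereal s" "ereal s < D - 1"
        using ereal_dense2 by (metis not_le)
      obtain t where t: "ereal s < ereal t" "ereal t < D - 1"
        using ereal_dense2[OF s(2)] by blast
      \<comment> \<open>Nonemptiness of \<open>G\<close> gives it dimension at least 0, hence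
        \<open>s > 0\<close>, as needed for adding a point to a null set.\<close>
      have "p \<in> G" using H(2) by (simp add: G_def)
      then have "s > 0"
        using s(1) hausdorff_dim_nonneg[of G] by (metis empty_iff ereal_less(2) le_less_trans)
      obtain f where f: "f \<in> \<Inter>\<E>" using Baire_nonempty[OF cE open_dense] by blast
      have "ereal (t + 1) < D" using t(2) by (cases D) (auto simp: one_ereal_def)
      from thickE[OF f this] obtain a b :: real where
        "a < b" "\<forall>y\<in>{a..b}. hausdorff_dim (apply_bcontfun f -` {y}) \<ge> ereal (t + 1) - 1"
        by blast
      then have "ereal t \<le> hausdorff_dim (apply_bcontfun f -` {a})"
        by (auto simp: one_ereal_def)
      moreover have "hausdorff_dim (apply_bcontfun f -` {a}) \<le> ereal s"
        using hausdorff_null_vimage_singleton[OF injG[OF f] hausdorff_null_if_dim_less[OF s(1)] \<open>s > 0\<close>]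
          \<open>s > 0\<close> by (intro hausdorff_dim_le) auto
      ultimately show False using t(1) by (meson leD order_trans)
    qed
  qed
  moreover have "comeager {f :: 'a \<Rightarrow>\<^sub>C real. inj_on (apply_bcontfun f) (UNIV - G) \<and>
      (\<forall>y. hausdorff_dim (apply_bcontfun f -` {y}) \<le> D - 1) \<and>
      (\<forall>d. d < D \<longrightarrow> (\<exists>a b. a < b \<and>
            (\<forall>y\<in>{a..b}. hausdorff_dim (apply_bcontfun f -` {y}) \<ge> d - 1)))}"
    using injG levels thickE
    by (intro comeagerI[OF cE open_dense]) (auto simp: Compl_eq_Diff_UNIV)
  ultimately show ?thesis
    using \<open>gdelta_in euclidean G\<close> unfolding D_def by blast
qed

end
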